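(* For every $n\ge 4$, the path $P_n$ with $n$ vertices is neither $\chi$-unfrozen nor $\omega$-unfrozen.
   Context: Graphs are finite, undirected, simple, without loops. $P_n = (\{v_1,\ldots,v_n\},\{\{v_i,v_{i+1}\} \mid 1\le i<n\})$. $\omega(G)$ is the size of a maximum clique and $\chi(G)$ the chromatic number. A nonedge of $G$ is a pair $e=\{u,v\}$ of distinct vertices with $e\notin E(G)$; $G+e$ is $G$ with $e$ added as an edge. For a parameter $\xi$, $G$ is $\xi$-unfrozen if $\xi(G+e)=\xi(G)$ for every nonedge $e$ of $G$. *)

theory Defs
  imports Main
begin

type_synonym 'a graph = "'a set \<times> 'a set set"

abbreviation verts :: "'a graph \<Rightarrow> 'a set" where
  "verts G \<equiv> fst G"

abbreviation edges :: "'a graph \<Rightarrow> 'a set set" where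
  "edges G \<equiv> snd G"

definition simple_graph :: "'a graph \<Rightarrow> bool" where
  "simple_graph G \<longleftrightarrow> finite (verts G) \<and> (\<forall>e \<in> edges G. e \<subseteq> verts G \<and> card e = 2)"

definition clique :: "'a graph \<Rightarrow> 'a set \<Rightarrow> bool" where
  "clique G C \<longleftrightarrow> C \<subseteq> verts G \<and> (\<forall>u \<in> C. \<forall>v \<in> C. u \<noteq> v \<longrightarrow> {u, v} \<in> edges G)"

definition clique_number :: "'a graph \<Rightarrow> nat" where
  "clique_number G = Max {card C |C. clique G C}"

definition proper_colouring :: "'a graph \<Rightarrow> nat \<Rightarrow> ('a \<Rightarrow> nat) \<Rightarrow> bool" where
  "proper_colouring G k c \<longleftrightarrow> c ` verts G \<subseteq> {..<k} \<and>
     (\<forall>u \<in> verts G. \<forall>v \<in> verts G. {u, v} \<in> edges G \<longrightarrow> c u \<noteq> c v)"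

definition chromatic_number :: "'a graph \<Rightarrow> nat" where
  "chromatic_number G = (LEAST k. \<exists>c. proper_colouring G k c)"

definition nonedges :: "'a graph \<Rightarrow> 'a set set" where
  "nonedges G = {{u, v} |u v. u \<in> verts G \<and> v \<in> verts G \<and> u \<noteq> v \<and> {u, v} \<notin> edges G}"

definition add_edge :: "'a graph \<Rightarrow> 'a set \<Rightarrow> 'a graph" where
  "add_edge G e = (verts G, insert e (edges G))"

definition unfrozen :: "('a graph \<Rightarrow> nat) \<Rightarrow> 'a graph \<Rightarrow> bool" where
  "unfrozen \<xi> G \<longleftrightarrow> (\<forall>e \<in> nonedges G. \<xi> (add_edge G e) = \<xi> G)"

(* The vertex v_i is represented by the number i. *)
definition path_graph :: "nat \<Rightarrow> nat graph" where
  "path_graph n = ({1..n}, {{i, i + 1} |i. 1 \<le> i \<and> i < n})"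

(* Max and LEAST are only meaningful on a nonempty finite set and for a satisfiable
   predicate, respectively; the following facts show that this is so for simple graphs. *)

lemma simple_graph_path_graph: "simple_graph (path_graph n)"
  by (auto simp: simple_graph_def path_graph_def)

lemma simple_graph_add_edge:
  "simple_graph G \<Longrightarrow> e \<in> nonedges G \<Longrightarrow> simple_graph (add_edge G e)"
  by (auto simp: simple_graph_def nonedges_def add_edge_def)

lemma clique_cards_finite:
  assumes "simple_graph G"
  shows "finite {card C |C. clique G C}"
proof (rule finite_subset)
  show "{card C |C. clique G C} \<subseteq> card ` Pow (verts G)"
    by (auto simp: clique_def)
  show "finite (card ` Pow (verts G))"
    using assms by (simp add: simple_graph_def)
qed

lemma clique_cards_nonempty: "{card C |C. clique G C} \<noteq> {}"
proof -
  have "clique G {}" by (simp add: clique_def)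
  then show ?thesis by blast
qed

lemma proper_colouring_exists:
  assumes "simple_graph G"
  shows "\<exists>k c. proper_colouring G k c"
proof -
  have "finite (verts G)" using assms by (simp add: simple_graph_def)
  then obtain c :: "'a \<Rightarrow> nat" and k where c: "c ` verts G = {i. i < k}" "inj_on c (verts G)"
    using finite_imp_inj_to_nat_seg by metis
  have "c u \<noteq> c v" if "u \<in> verts G" "v \<in> verts G" "{u, v} \<in> edges G" for u v
  proof
    assume "c u = c v"
    with c(2) that have "u = v" by (auto dest: inj_onD)
    with that assms show False by (auto simp: simple_graph_def)
  qed
  then have "proper_colouring G k c"
    using c(1) by (auto simp: proper_colouring_def)
  then show ?thesis by blast
qed

end

(* Joining v_1 and v_3 creates a triangle. A clique receives pairwise distinct colours, so omega and
   chi are then at least 3, while the parity colouring gives omega \<le> chi \<le> 2 for the path itself. *)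
theory Submission
  imports Defs
begin

lemma card_clique_le_clique_number:
  assumes "simple_graph G" "clique G C"
  shows "card C \<le> clique_number G"
  unfolding clique_number_def
  using clique_cards_finite[OF assms(1)] assms(2) by (intro Max_ge) auto

lemma chromatic_number_le:
  assumes "proper_colouring G k c"
  shows "chromatic_number G \<le> k"
  unfolding chromatic_number_def using assms by (blast intro: Least_le)

text \<open>A simple graph has some proper colouring, so the \<open>LEAST\<close> is attained by a
  colouring \<open>c\<close>. Distinct vertices of \<open>C\<close> are adjacent, hence
  \<open>c\<close> maps \<open>C\<close> injectively into the available colours.\<close>

lemma card_clique_le_chromatic_number:
  assumes "simple_graph G" "clique G C"
  shows "card C \<le> chromatic_number G"
proof -
  have "\<exists>c. proper_colouring G (chromatic_number G) c"
    unfolding chromatic_number_def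
    using proper_colouring_exists[OF assms(1)] by (rule LeastI_ex)
  then obtain c where c: "proper_colouring G (chromatic_number G) c" ..
  have "inj_on c C"
    using c assms(2) unfolding proper_colouring_def clique_def inj_on_def by blast
  moreover have "c ` C \<subseteq> {..<chromatic_number G}"
    using c assms(2) unfolding proper_colouring_def clique_def by blast
  ultimately have "card C \<le> card {..<chromatic_number G}"
    by (intro card_inj_on_le) auto
  then show ?thesis by simp
qed

text \<open>The \<open>Max\<close> is attained by an actual clique, to which the previous bound
  applies.\<close>

lemma clique_number_le_chromatic_number:
  assumes "simple_graph G"
  shows "clique_number G \<le> chromatic_number G"
proof -
  have "clique_number G \<in> {card C |C. clique G C}"
    unfolding clique_number_def
    using clique_cards_finite[OF assms] clique_cards_nonempty by (rule Max_in)
  then show ?thesis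
    using card_clique_le_chromatic_number[OF assms] by auto
qed

text \<open>Turns adjacency into arithmetic; the disjunction arises because an unordered pair can be
  matched with \<open>{i, i + 1}\<close> in two ways.\<close>

lemma edges_path_graph_iff:
  "{u, v} \<in> edges (path_graph n) \<longleftrightarrow>
     1 \<le> u \<and> 1 \<le> v \<and> u \<le> n \<and> v \<le> n \<and> (v = u + 1 \<or> u = v + 1)"
  by (auto simp: path_graph_def doubleton_eq_iff)

lemma chromatic_number_path_graph_le: "chromatic_number (path_graph n) \<le> 2"
proof (rule chromatic_number_le)
  \<comment> \<open>Adjacent vertices are consecutive numbers, so their parities differ.\<close>
  show "proper_colouring (path_graph n) 2 (\<lambda>i. i mod 2)"
    unfolding proper_colouring_def edges_path_graph_iff by (auto, presburger+)
qed

theorem proposition3: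
  fixes n :: nat
  assumes "n \<ge> 4"
  shows "\<not> unfrozen chromatic_number (path_graph n) \<and> \<not> unfrozen clique_number (path_graph n)"
proof -
  let ?P = "path_graph n" and ?e = "{1, 3} :: nat set"
  \<comment> \<open>The assumption on \<open>n\<close> puts 3 among the vertices; 1 and 3 are not
    consecutive.\<close>
  have "1 \<in> verts ?P" "3 \<in> verts ?P" "?e \<notin> edges ?P"
    using assms unfolding edges_path_graph_iff by (simp_all add: path_graph_def)
  then have e: "?e \<in> nonedges ?P"
    unfolding nonedges_def using numeral_eq_one_iff by fastforce
  have simple: "simple_graph (add_edge ?P ?e)"
    using simple_graph_path_graph e by (rule simple_graph_add_edge)
  have "{1, 2} \<in> edges ?P" "{2, 3} \<in> edges ?P" "{1, 2, 3} \<subseteq> verts ?P"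
    using assms unfolding edges_path_graph_iff by (simp_all add: path_graph_def)
  \<comment> \<open>Two sides are path edges and the third is \<open>?e\<close>;
    \<open>insert_commute\<close> covers both orders of each pair.\<close>
  then have triangle: "clique (add_edge ?P ?e) {1, 2, 3}"
    by (auto simp: clique_def add_edge_def insert_commute)
  have "3 \<le> chromatic_number (add_edge ?P ?e)" "3 \<le> clique_number (add_edge ?P ?e)"
    using card_clique_le_chromatic_number[OF simple triangle]
      card_clique_le_clique_number[OF simple triangle] by simp_all
  \<comment> \<open>The bound on cliques needs no separate argument: it is inherited from the
    colouring.\<close>
  moreover have "chromatic_number ?P \<le> 2" "clique_number ?P \<le> 2"
    using chromatic_number_path_graph_le[of n]
      clique_number_le_chromatic_number[OF simple_graph_path_graph, of n] by simp_all
  ultimately have "chromatic_number (add_edge ?P ?e) \<noteq> chromatic_number ?P"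
    "clique_number (add_edge ?P ?e) \<noteq> clique_number ?P"
    by linarith+
  then show ?thesis
    using e unfolding unfrozen_def by blast
qed

end
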